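(* For every positive integer $M$ and every positive integer $N$, with variables $x_1,\dots,x_N,y_1,\dots,y_N$, one has (as formal power series in these variables) $$\langle 0|\mathbf{C}^{*}(x_N)\cdots\mathbf{C}^{*}(x_1)\mathbf{B}^{*}(y_1)\cdots \mathbf{B}^{*}(y_N)|0\rangle=\frac{1}{\langle 0|\mathbf{C}(x_N)\cdots\mathbf{C}(x_1)\mathbf{B}(y_1)\cdots \mathbf{B}(y_N)|0\rangle},$$ where the left side is computed in the charged free boson system and the right side in the $bc$ fermion system.
   Context: Fermions. $b(i),c(i)$ ($i\in\mathbb Z$) satisfy $\{b(i),c(j)\}=\delta_{i,-j}$, $\{b(i),b(j)\}=\{c(i),c(j)\}=0$, where $\{A,B\}=AB+BA$. The vacuum satisfies $b(m+1)|0\rangle=c(m)|0\rangle=0$ for $m\ge 0$; the dual vacuum satisfies $\langle 0|b(i+1)=\langle 0|c(i)=0$ for $i<0$. For fixed $M$, $$\mathbf B(x)=\exp(x\,b(-M+1)c(M-2))\exp(x\,b(-M+2)c(M-3))\cdots,$$ the ordered product of the factors $\exp(x\,b(-(i-1))c(i-2))$, $i\le M$, with $i$ decreasing from left to right, and $$\mathbf C(x)=\cdots\exp(x\,b(-M+3)c(M-2))\exp(x\,b(-M+2)c(M-1)),$$ the ordered product of the factors $\exp(x\,b(-i+2)c(i-1))$, $i\le M$, with $i$ decreasing from right to left. Bosons. $\varphi_i,\varphi^*_i$ ($i\in\mathbb Z$) satisfy $[\varphi_i,\varphi^*_j]=\delta_{i,-j}$, $[\varphi_i,\varphi_j]=[\varphi^*_i,\varphi^*_j]=0$.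 The (bosonic) vacuum satisfies $\varphi_i|0\rangle=\varphi^*_{i+1}|0\rangle=0$ for $i\ge0$, and the dual vacuum satisfies $\langle 0|\varphi_i=\langle0|\varphi^*_{i+1}=0$ for $i<0$. For the same $M$, $$\mathbf B^*(x)=\exp(x\varphi_{-M}\varphi^*_{M-1})\exp(x\varphi_{-M+1}\varphi^*_{M-2})\cdots,\qquad \mathbf C^*(x)=\cdots\exp(x\varphi_{-M+2}\varphi^*_{M-1})\exp(x\varphi_{-M+1}\varphi^*_{M}),$$ i.e. the ordered products of $\exp(x\varphi_{-i}\varphi^*_{i-1})$ ($i\le M$, $i$ decreasing from left to right) and of $\exp(x\varphi_{-i+1}\varphi^*_{i})$ ($i\le M$, $i$ decreasing from right to left). Vacuum expectation values. In the fermion system, $\langle 0|a|0\rangle$ denotes the vacuum expectation value determined by the anticommutation relations $\{b(i),c(j)\}=\delta_{i,-j}$, $\{b(i),b(j)\}=\{c(i),c(j)\}=0$, the vacuum conditions $b(m+1)|0\rangle=c(m)|0\rangle=0$ ($m\ge0$) and $\langle 0|b(i+1)=\langle 0|c(i)=0$ ($i<0$), and the normalization $\langle 0|1|0\rangle=1$. In the boson system, $\langle 0|a|0\rangle$ denotes the vacuum expectation value determined by the commutation relations $[\varphi_i,\varphi^*_j]=\delta_{i,-j}$, $[\varphi_i,\varphi_j]=[\varphi^*_i,\varphi^*_j]=0$, the vacuum conditions $\varphi_i|0\rangle=\varphi^*_{i+1}|0\rangle=0$ ($i\ge0$) and $\langle 0|\varphi_i=\langle0|\varphi^*_{i+1}=0$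 ($i<0$), and the normalization $\langle 0|1|0\rangle=1$. In each infinite product, for each fixed vector and each power of $x$ only finitely many terms contribute. *)

theory Defs
  imports Complex_Main "HOL-Library.Multiset"
begin

section \<open>Multivariate formal power series\<close>

text \<open>
  A monomial in the variables \<open>'x\<close> is a multiset of variables, and a formal power series is the
  family of its coefficients.
\<close>

typedef ('x, 'a) mps = "UNIV :: ('x multiset \<Rightarrow> 'a) set"
  morphisms mps_coeff Abs_mps ..

setup_lifting type_definition_mps

lemma mps_eq_iff: "f = g \<longleftrightarrow> (\<forall>m. mps_coeff f m = mps_coeff g m)"
  by transfer auto

definition splittings :: "'x multiset \<Rightarrow> ('x multiset \<times> 'x multiset) set" where
  "splittings m = {(p, q). p + q = m}"

lemma finite_splittings [simp]: "finite (splittings m)"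
proof (induction m)
  case empty
  show ?case by (simp add: splittings_def)
next
  case (add x m)
  have "splittings (add_mset x m) \<subseteq>
      (\<lambda>(p, q). (add_mset x p, q)) ` splittings m \<union> (\<lambda>(p, q). (p, add_mset x q)) ` splittings m"
  proof
    fix pq assume "pq \<in> splittings (add_mset x m)"
    then obtain p q where pq: "pq = (p, q)" "p + q = add_mset x m"
      by (auto simp: splittings_def)
    then have "x \<in># p \<or> x \<in># q"
      by (metis union_iff union_single_eq_member)
    then show "pq \<in> (\<lambda>(p, q). (add_mset x p, q)) ` splittings m \<union>
        (\<lambda>(p, q). (p, add_mset x q)) ` splittings m"
    proof
      assume "x \<in># p"
      then obtain p' where "p = add_mset x p'" by (metis multi_member_split)
      with pq show ?thesis by (auto simp: splittings_def image_iff)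
    next
      assume "x \<in># q"
      then obtain q' where "q = add_mset x q'" by (metis multi_member_split)
      with pq show ?thesis by (auto simp: splittings_def image_iff)
    qed
  qed
  then show ?case using add.IH by (meson finite_Un finite_imageI finite_subset)
qed

instantiation mps :: (type, comm_ring_1) comm_ring_1
begin

lift_definition zero_mps :: "('a, 'b) mps" is "\<lambda>_. 0" .
lift_definition one_mps :: "('a, 'b) mps" is "\<lambda>m. if m = {#} then 1 else 0" .
lift_definition plus_mps :: "('a, 'b) mps \<Rightarrow> ('a, 'b) mps \<Rightarrow> ('a, 'b) mps" is "\<lambda>f g m. f m + g m" .
lift_definition minus_mps :: "('a, 'b) mps \<Rightarrow> ('a, 'b) mps \<Rightarrow> ('a, 'b) mps" is "\<lambda>f g m. f m - g m" .
lift_definition uminus_mps :: "('a, 'b) mps \<Rightarrow> ('a, 'b) mps" is "\<lambda>f m. - f m" .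
lift_definition times_mps :: "('a, 'b) mps \<Rightarrow> ('a, 'b) mps \<Rightarrow> ('a, 'b) mps" is
  "\<lambda>f g m. \<Sum>(p, q)\<in>splittings m. f p * g q" .

instance
proof
  fix f g h :: "('a, 'b) mps"
  show "f * g * h = f * (g * h)"
  proof (transfer, rule ext)
    fix f g h :: "'a multiset \<Rightarrow> 'b" and m
    have "(\<Sum>(p, q)\<in>splittings m. (\<Sum>(a, b)\<in>splittings p. f a * g b) * h q) =
        (\<Sum>(pq, ab)\<in>(SIGMA pq:splittings m. splittings (fst pq)). f (fst ab) * g (snd ab) * h (snd pq))"
      by (subst sum.Sigma [symmetric]) (auto simp: sum_distrib_right case_prod_beta)
    also have "\<dots> =
        (\<Sum>(pq, ab)\<in>(SIGMA pq:splittings m. splittings (snd pq)). f (fst pq) * g (fst ab) * h (snd ab))"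
      by (rule sum.reindex_bij_witness
            [where i = "\<lambda>((p, q), (a, b)). ((p + a, b), (p, a))"
               and j = "\<lambda>((p, q), (a, b)). ((a, b + q), (b, q))"])
         (auto simp: splittings_def add.assoc)
    also have "\<dots> = (\<Sum>(p, q)\<in>splittings m. f p * (\<Sum>(a, b)\<in>splittings q. g a * h b))"
      by (subst sum.Sigma [symmetric]) (auto simp: sum_distrib_left case_prod_beta mult.assoc)
    finally show "(\<Sum>(p, q)\<in>splittings m. (\<Sum>(a, b)\<in>splittings p. f a * g b) * h q) =
        (\<Sum>(p, q)\<in>splittings m. f p * (\<Sum>(a, b)\<in>splittings q. g a * h b))" .
  qed
  show "f * g = g * f"
  proof (transfer, rule ext)
    fix f g :: "'a multiset \<Rightarrow> 'b" and m
    show "(\<Sum>(p, q)\<in>splittings m. f p * g q) = (\<Sum>(p, q)\<in>splittings m. g p * f q)"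
      by (rule sum.reindex_bij_witness [where i = prod.swap and j = prod.swap])
         (auto simp: splittings_def add.commute mult.commute)
  qed
  show "1 * f = f"
  proof (transfer, rule ext)
    fix f :: "'a multiset \<Rightarrow> 'b" and m
    have "(\<Sum>(p, q)\<in>splittings m. (if p = {#} then 1 else 0) * f q) =
        (\<Sum>(p, q)\<in>{({#} :: 'a multiset, m)}. (if p = {#} then 1 else 0) * f q)"
      by (rule sum.mono_neutral_right) (simp, auto simp: splittings_def split: if_splits)
    then show "(\<Sum>(p, q)\<in>splittings m. (if p = {#} then 1 else 0) * f q) = f m" by simp
  qed
  show "(f + g) * h = f * h + g * h"
    by transfer (auto simp: distrib_right sum.distrib case_prod_beta)
  show "(0 :: ('a, 'b) mps) \<noteq> 1"
    by transfer (auto simp: fun_eq_iff)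
qed (transfer; simp add: fun_eq_iff add.assoc add.commute)+

end

section \<open>The \<open>bc\<close> fermion system and the charged free boson system\<close>

text \<open>
  The dual vacuum is a linear functional \<open>bra\<close>, so \<open>\<langle>0|A = 0\<close> reads \<open>bra (A v) = 0\<close> for all \<open>v\<close>.
  The expectation value of a word in the generators is determined by these axioms, hence does not
  depend on which system is taken.
\<close>

locale bc_fermions = vector_space scale
  for scale :: "'a::field_char_0 \<Rightarrow> 'v::ab_group_add \<Rightarrow> 'v" +
  fixes b c :: "int \<Rightarrow> 'v \<Rightarrow> 'v" and vac :: 'v and bra :: "'v \<Rightarrow> 'a"
  assumes linear_b: "Vector_Spaces.linear scale scale (b i)"
    and linear_c: "Vector_Spaces.linear scale scale (c i)"
    and linear_bra: "Vector_Spaces.linear scale (*) bra"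
    and anticomm_bc: "b i (c j v) + c j (b i v) = (if i = - j then v else 0)"
    and anticomm_bb: "b i (b j v) + b j (b i v) = 0"
    and anticomm_cc: "c i (c j v) + c j (c i v) = 0"
    and b_vac: "m \<ge> 0 \<Longrightarrow> b (m + 1) vac = 0"
    and c_vac: "m \<ge> 0 \<Longrightarrow> c m vac = 0"
    and bra_b: "i < 0 \<Longrightarrow> bra (b (i + 1) v) = 0"
    and bra_c: "i < 0 \<Longrightarrow> bra (c i v) = 0"
    and bra_vac: "bra vac = 1"

locale charged_bosons = vector_space scale
  for scale :: "'a::field_char_0 \<Rightarrow> 'v::ab_group_add \<Rightarrow> 'v" +
  fixes \<phi> \<phi>s :: "int \<Rightarrow> 'v \<Rightarrow> 'v" and vac :: 'v and bra :: "'v \<Rightarrow> 'a"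
  assumes linear_phi: "Vector_Spaces.linear scale scale (\<phi> i)"
    and linear_phis: "Vector_Spaces.linear scale scale (\<phi>s i)"
    and linear_bra: "Vector_Spaces.linear scale (*) bra"
    and comm_phi_phis: "\<phi> i (\<phi>s j v) - \<phi>s j (\<phi> i v) = (if i = - j then v else 0)"
    and comm_phi_phi: "\<phi> i (\<phi> j v) - \<phi> j (\<phi> i v) = 0"
    and comm_phis_phis: "\<phi>s i (\<phi>s j v) - \<phi>s j (\<phi>s i v) = 0"
    and phi_vac: "i \<ge> 0 \<Longrightarrow> \<phi> i vac = 0"
    and phis_vac: "i \<ge> 0 \<Longrightarrow> \<phi>s (i + 1) vac = 0"
    and bra_phi: "i < 0 \<Longrightarrow> bra (\<phi> i v) = 0"
    and bra_phis: "i < 0 \<Longrightarrow> bra (\<phi>s (i + 1) v) = 0"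
    and bra_vac: "bra vac = 1"

section \<open>Operator-valued series and infinite products\<close>

text \<open>
  An operator-valued series \<open>F(x) = \<Sum>\<^sub>n F\<^sub>n x\<^sup>n\<close> in one variable is the function \<open>n \<mapsto> F\<^sub>n\<close>.
\<close>

type_synonym 'v opser = "nat \<Rightarrow> 'v \<Rightarrow> 'v"

definition opser_one :: "'v::zero opser" where
  "opser_one n v = (if n = 0 then v else 0)"

definition opser_mult :: "'v::comm_monoid_add opser \<Rightarrow> 'v opser \<Rightarrow> 'v opser" where
  "opser_mult F G n v = (\<Sum>k\<le>n. F k (G (n - k) v))"

definition opser_exp :: "('a::field_char_0 \<Rightarrow> 'v \<Rightarrow> 'v) \<Rightarrow> ('v \<Rightarrow> 'v) \<Rightarrow> 'v opser" where
  "opser_exp scale A n v = scale (inverse (fact n)) ((A ^^ n) v)"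

text \<open>The partial products \<open>F\<^sub>0 F\<^sub>1 \<cdots> F\<^bsub>K-1\<^esub>\<close> and \<open>F\<^bsub>K-1\<^esub> \<cdots> F\<^sub>1 F\<^sub>0\<close>.\<close>

primrec prod_rightwards :: "(nat \<Rightarrow> 'v::comm_monoid_add opser) \<Rightarrow> nat \<Rightarrow> 'v opser" where
  "prod_rightwards F 0 = opser_one"
| "prod_rightwards F (Suc K) = opser_mult (prod_rightwards F K) (F K)"

primrec prod_leftwards :: "(nat \<Rightarrow> 'v::comm_monoid_add opser) \<Rightarrow> nat \<Rightarrow> 'v opser" where
  "prod_leftwards F 0 = opser_one"
| "prod_leftwards F (Suc K) = opser_mult (F K) (prod_leftwards F K)"

text \<open>
  On a fixed vector each coefficient of the partial products is eventually constant (on every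
  vector obtained from the vacuum); the infinite product is that stable value.
\<close>

definition opser_lim :: "(nat \<Rightarrow> 'v opser) \<Rightarrow> 'v opser" where
  "opser_lim P n v = (THE w. \<forall>\<^sub>F K in sequentially. P K n v = w)"

text \<open>In the four products the factor with index \<open>j\<close> is the one for \<open>i = M - j\<close>.\<close>

definition B_op ::
  "('a::field_char_0 \<Rightarrow> 'v::ab_group_add \<Rightarrow> 'v) \<Rightarrow> (int \<Rightarrow> 'v \<Rightarrow> 'v) \<Rightarrow> (int \<Rightarrow> 'v \<Rightarrow> 'v) \<Rightarrow> int \<Rightarrow> 'v opser"
where
  "B_op scale b c M = opser_lim (prod_rightwards
     (\<lambda>j. let i = M - int j in opser_exp scale (\<lambda>v. b (- (i - 1)) (c (i - 2) v))))"

definition C_op ::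
  "('a::field_char_0 \<Rightarrow> 'v::ab_group_add \<Rightarrow> 'v) \<Rightarrow> (int \<Rightarrow> 'v \<Rightarrow> 'v) \<Rightarrow> (int \<Rightarrow> 'v \<Rightarrow> 'v) \<Rightarrow> int \<Rightarrow> 'v opser"
where
  "C_op scale b c M = opser_lim (prod_leftwards
     (\<lambda>j. let i = M - int j in opser_exp scale (\<lambda>v. b (- i + 2) (c (i - 1) v))))"

definition Bs_op ::
  "('a::field_char_0 \<Rightarrow> 'v::ab_group_add \<Rightarrow> 'v) \<Rightarrow> (int \<Rightarrow> 'v \<Rightarrow> 'v) \<Rightarrow> (int \<Rightarrow> 'v \<Rightarrow> 'v) \<Rightarrow> int \<Rightarrow> 'v opser"
where
  "Bs_op scale \<phi> \<phi>s M = opser_lim (prod_rightwards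
     (\<lambda>j. let i = M - int j in opser_exp scale (\<lambda>v. \<phi> (- i) (\<phi>s (i - 1) v))))"

definition Cs_op ::
  "('a::field_char_0 \<Rightarrow> 'v::ab_group_add \<Rightarrow> 'v) \<Rightarrow> (int \<Rightarrow> 'v \<Rightarrow> 'v) \<Rightarrow> (int \<Rightarrow> 'v \<Rightarrow> 'v) \<Rightarrow> int \<Rightarrow> 'v opser"
where
  "Cs_op scale \<phi> \<phi>s M = opser_lim (prod_leftwards
     (\<lambda>j. let i = M - int j in opser_exp scale (\<lambda>v. \<phi> (- i + 1) (\<phi>s i v))))"

section \<open>Vacuum expectation values\<close>

datatype var = X nat | Y nat

text \<open>
  Vectors depending on the variables are vector-valued power series \<open>var multiset \<Rightarrow> 'v\<close>.
  \<open>apply_at z F\<close> is the action of \<open>F(z)\<close> on them, extended linearly over the power series.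
\<close>

definition apply_at :: "var \<Rightarrow> 'v::comm_monoid_add opser \<Rightarrow> (var multiset \<Rightarrow> 'v) \<Rightarrow> (var multiset \<Rightarrow> 'v)" where
  "apply_at z F \<psi> m = (\<Sum>n\<le>count m z. F n (\<psi> (m - replicate_mset n z)))"

definition const_vec :: "'v::zero \<Rightarrow> var multiset \<Rightarrow> 'v" where
  "const_vec v m = (if m = {#} then v else 0)"

text \<open>\<open>\<langle>0| C(x\<^sub>N) \<cdots> C(x\<^sub>1) B(y\<^sub>1) \<cdots> B(y\<^sub>N) |0\<rangle>\<close>\<close>

definition vev_CB ::
  "'v::comm_monoid_add opser \<Rightarrow> 'v opser \<Rightarrow> 'v \<Rightarrow> ('v \<Rightarrow> 'a) \<Rightarrow> nat \<Rightarrow> (var, 'a) mps"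
where
  "vev_CB C B vac bra N = Abs_mps (\<lambda>m. bra
     (foldr (\<lambda>k. apply_at (X k) C) (rev [1..<Suc N])
       (foldr (\<lambda>k. apply_at (Y k) B) [1..<Suc N] (const_vec vac)) m))"

section \<open>Both systems exist\<close>

text \<open>
  Both models live on families of scalars indexed by multisets of integers. For fermions the
  mode \<open>p\<close> counts as occupied when its multiplicity is odd, which avoids a separate type of
  finite sets.
\<close>

definition mps_scale :: "'a::comm_ring_1 \<Rightarrow> ('x, 'a) mps \<Rightarrow> ('x, 'a) mps" where
  "mps_scale a f = Abs_mps (\<lambda>m. a * mps_coeff f m)"

lemma mps_coeff_simps [simp]:
  "mps_coeff (Abs_mps F) m = F m"
  "mps_coeff 0 m = 0"
  "mps_coeff (f + g) m = mps_coeff f m + mps_coeff g m"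
  "mps_coeff (f - g) m = mps_coeff f m - mps_coeff g m"
  "mps_coeff (- f) m = - mps_coeff f m"
  "mps_coeff (mps_scale a f) m = a * mps_coeff f m"
  by (simp_all add: Abs_mps_inverse mps_scale_def zero_mps.rep_eq plus_mps.rep_eq
      minus_mps.rep_eq uminus_mps.rep_eq)

lemma vector_space_mps: "vector_space (mps_scale :: 'a::field \<Rightarrow> ('x, 'a) mps \<Rightarrow> _)"
  by unfold_locales (auto simp: mps_eq_iff algebra_simps)

lemma linear_mpsI:
  fixes f :: "('x, 'a::field) mps \<Rightarrow> ('x, 'a) mps"
  assumes "\<And>u v. f (u + v) = f u + f v" and "\<And>a v. f (mps_scale a v) = mps_scale a (f v)"
  shows "Vector_Spaces.linear mps_scale mps_scale f"
proof -
  interpret vector_space "mps_scale :: 'a \<Rightarrow> ('x, 'a) mps \<Rightarrow> _" by (rule vector_space_mps)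
  show ?thesis by unfold_locales (use assms in auto)
qed

lemma linear_mps_coeff:
  "Vector_Spaces.linear mps_scale (*) (\<lambda>f :: ('x, 'a::field) mps. mps_coeff f m)"
proof -
  interpret vector_space "mps_scale :: 'a \<Rightarrow> ('x, 'a) mps \<Rightarrow> _" by (rule vector_space_mps)
  show ?thesis by unfold_locales (auto simp: algebra_simps)
qed

definition fsign :: "int \<Rightarrow> int multiset \<Rightarrow> 'a::comm_ring_1" where
  "fsign p T = (-1) ^ size (filter_mset (\<lambda>t. t < p) T)"

definition fcreate :: "int \<Rightarrow> (int, 'a::comm_ring_1) mps \<Rightarrow> (int, 'a) mps" where
  "fcreate p f = Abs_mps (\<lambda>T. if odd (count T p) then fsign p T * mps_coeff f (T - {#p#}) else 0)"

definition fannihilate :: "int \<Rightarrow> (int, 'a::comm_ring_1) mps \<Rightarrow> (int, 'a) mps" where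
  "fannihilate p f = Abs_mps (\<lambda>T. if even (count T p) then fsign p T * mps_coeff f (add_mset p T) else 0)"

definition bcreate :: "int \<Rightarrow> (int, 'a::comm_ring_1) mps \<Rightarrow> (int, 'a) mps" where
  "bcreate p f = Abs_mps (\<lambda>T. if p \<in># T then mps_coeff f (T - {#p#}) else 0)"

definition bannihilate :: "int \<Rightarrow> (int, 'a::comm_ring_1) mps \<Rightarrow> (int, 'a) mps" where
  "bannihilate p f = Abs_mps (\<lambda>T. of_nat (Suc (count T p)) * mps_coeff f (add_mset p T))"

definition mps_vac :: "(int, 'a::comm_ring_1) mps" where
  "mps_vac = Abs_mps (\<lambda>T. if T = {#} then 1 else 0)"

lemma linear_modes:
  "Vector_Spaces.linear mps_scale mps_scale (fcreate p :: (int, 'a::field) mps \<Rightarrow> _)"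
  "Vector_Spaces.linear mps_scale mps_scale (fannihilate p :: (int, 'a::field) mps \<Rightarrow> _)"
  "Vector_Spaces.linear mps_scale mps_scale (bcreate p :: (int, 'a::field) mps \<Rightarrow> _)"
  "Vector_Spaces.linear mps_scale mps_scale (bannihilate p :: (int, 'a::field) mps \<Rightarrow> _)"
  "Vector_Spaces.linear mps_scale mps_scale (\<lambda>v :: (int, 'a::field) mps. - bannihilate p v)"
  by (rule linear_mpsI; auto simp: mps_eq_iff fcreate_def fannihilate_def bcreate_def
      bannihilate_def algebra_simps)+

lemma fsign_add: "fsign p (add_mset q T) = (if q < p then - fsign p T else fsign p T)"
  by (simp add: fsign_def)

lemma fsign_diff:
  "q \<in># T \<Longrightarrow> fsign p (T - {#q#}) = (if q < p then - fsign p T else (fsign p T :: 'a::comm_ring_1))"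
  by (metis fsign_add add.inverse_inverse insert_DiffM)

lemma fsign_sq: "fsign p T * (fsign p T * x) = (x :: 'a::comm_ring_1)"
  by (simp add: fsign_def flip: mult.assoc power_add)

lemma odd_count_mem: "odd (count T p) \<Longrightarrow> p \<in># T"
  by (metis count_eq_zero_iff even_zero)

lemma fermi_same:
  fixes f :: "(int, 'a::comm_ring_1) mps"
  shows "fcreate p (fannihilate p f) + fannihilate p (fcreate p f) = f"
    and "fcreate p (fcreate p f) = 0" and "fannihilate p (fannihilate p f) = 0"
  by (auto simp: mps_eq_iff fcreate_def fannihilate_def fsign_add fsign_diff fsign_sq odd_count_mem)

lemma fermi_cross:
  fixes f :: "(int, 'a::comm_ring_1) mps"
  assumes "p \<noteq> q"
  shows "fcreate p (fannihilate q f) + fannihilate q (fcreate p f) = 0"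
    and "fannihilate p (fcreate q f) + fcreate q (fannihilate p f) = 0"
    and "fcreate p (fcreate q f) + fcreate q (fcreate p f) = 0"
    and "fannihilate p (fannihilate q f) + fannihilate q (fannihilate p f) = 0"
  using assms
  by (auto simp: mps_eq_iff fcreate_def fannihilate_def fsign_add fsign_diff odd_count_mem
      add_mset_commute diff_right_commute mult.left_commute)

lemma bc_fermions_exist:
  "bc_fermions (mps_scale :: 'a::field_char_0 \<Rightarrow> (int, 'a) mps \<Rightarrow> _)
     (\<lambda>i. if i \<le> 0 then fcreate (- i) else fannihilate (- i))
     (\<lambda>i. if i < 0 then fcreate i else fannihilate i)
     mps_vac (\<lambda>f. mps_coeff f {#})"
proof -
  have same: "fannihilate p (fcreate p f) + fcreate p (fannihilate p f) = f"
    for p and f :: "(int, 'a) mps"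
    using fermi_same(1) by (simp add: add.commute)
  let ?b = "\<lambda>i :: int. if i \<le> 0 then fcreate (- i) else fannihilate (- i) :: (int, 'a) mps \<Rightarrow> _"
  let ?c = "\<lambda>i :: int. if i < 0 then fcreate i else fannihilate i :: (int, 'a) mps \<Rightarrow> _"
  have bc: "?b i (?c j v) + ?c j (?b i v) = (if i = - j then v else 0)" for i j v
    by (cases "i = - j") (auto simp: fermi_same fermi_cross same)
  have bb: "?b i (?b j v) + ?b j (?b i v) = 0" for i j v
    by (cases "i = j") (auto simp: fermi_same fermi_cross)
  have cc: "?c i (?c j v) + ?c j (?c i v) = 0" for i j v
    by (cases "i = j") (auto simp: fermi_same fermi_cross)
  show ?thesis
    by (intro bc_fermions.intro bc_fermions_axioms.intro vector_space_mps)
       (rule bc bb cc linear_mps_coeff | (simp add: linear_modes; fail) |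
         (auto simp: mps_eq_iff fcreate_def fannihilate_def
           mps_vac_def)[1])+
qed

lemma bose_same:
  fixes f :: "(int, 'a::comm_ring_1) mps"
  shows "bannihilate p (bcreate p f) - bcreate p (bannihilate p f) = f"
  by (auto simp: mps_eq_iff bcreate_def bannihilate_def algebra_simps not_in_iff
      simp flip: count_greater_zero_iff)

lemma bose_cross:
  fixes f :: "(int, 'a::comm_ring_1) mps"
  shows "p \<noteq> q \<Longrightarrow> bannihilate p (bcreate q f) = bcreate q (bannihilate p f)"
    and "bcreate p (bcreate q f) = bcreate q (bcreate p f)"
    and "bannihilate p (bannihilate q f) = bannihilate q (bannihilate p f)"
    and "bannihilate p (- f) = - bannihilate p f" and "bcreate p (- f) = - bcreate p f"
proof -
  show "bcreate p (bcreate q f) = bcreate q (bcreate p f)"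
    by (cases "p = q") (auto simp: mps_eq_iff bcreate_def in_diff_count add_mset_commute)
qed (auto simp: mps_eq_iff bcreate_def bannihilate_def add_mset_commute mult.left_commute)

lemma charged_bosons_exist:
  "charged_bosons (mps_scale :: 'a::field_char_0 \<Rightarrow> (int, 'a) mps \<Rightarrow> _)
     (\<lambda>i. if i < 0 then bcreate (- i) else bannihilate (- i))
     (\<lambda>i. if i \<le> 0 then bcreate i else (\<lambda>f. - bannihilate i f))
     mps_vac (\<lambda>f. mps_coeff f {#})"
proof -
  have same: "bannihilate p (bcreate p f) = bcreate p (bannihilate p f) + f"
    for p and f :: "(int, 'a) mps"
    using bose_same[of p f] by (simp add: algebra_simps)
  let ?\<phi> = "\<lambda>i :: int. if i < 0 then bcreate (- i) else bannihilate (- i) :: (int, 'a) mps \<Rightarrow> _"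
  let ?\<phi>s = "\<lambda>i :: int. if i \<le> 0 then bcreate i else (\<lambda>f. - bannihilate i f) :: (int, 'a) mps \<Rightarrow> _"
  have pq: "?\<phi> i (?\<phi>s j v) - ?\<phi>s j (?\<phi> i v) = (if i = - j then v else 0)" for i j v
    by (cases "i = - j") (auto simp: same bose_cross(1,4,5) bose_cross(2,3)[of "- i" j v])
  have pp: "?\<phi> i (?\<phi> j v) - ?\<phi> j (?\<phi> i v) = 0" for i j v
    by (auto simp: bose_cross(1) bose_cross(2,3)[of "- i" "- j" v])
  have qq: "?\<phi>s i (?\<phi>s j v) - ?\<phi>s j (?\<phi>s i v) = 0" for i j v
    by (auto simp: bose_cross(1,4,5) bose_cross(2,3)[of i j v])
  show ?thesis
    by (intro charged_bosons.intro charged_bosons_axioms.intro vector_space_mps)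
       (rule pq pp qq linear_mps_coeff | (simp add: linear_modes; fail) |
         (auto simp: mps_eq_iff bcreate_def bannihilate_def
           mps_vac_def)[1])+
qed

end

theory Submission
  imports Defs
begin

text \<open>
  The product of the two expectation values is the expectation value of the combined operators
  \<open>C \<otimes> C\<^sup>*\<close>, \<open>B \<otimes> B\<^sup>*\<close> in the tensor product of the fermionic and the bosonic space, and it equals
  \<open>1\<close> because this combined system is supersymmetric.

  In detail, number the modes of both systems by the integers, with \<open>u p\<close> raising and \<open>d q\<close> lowering.
  For fermions \<open>u p = b(1 - p)\<close> and \<open>d q = c(q - 1)\<close>, for bosons \<open>u p = (-1)\<^sup>p \<phi>(-p)\<close> and
  \<open>d q = (-1)\<^bsup>q+1\<^esup> \<phi>\<^sup>*(q)\<close>. In this numbering the two systems satisfy the same axioms up to the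
  statistics sign \<open>s\<close> (locale \<open>oscillators\<close>), and in all four products \<open>B\<close>, \<open>C\<close>, \<open>B\<^sup>*\<close>, \<open>C\<^sup>*\<close> the
  factors are exponentials of hopping operators \<open>E\<^sub>p\<^sub>q = u p d q\<close> between neighbouring modes, in
  matching order. The alternating signs are what turns \<open>[\<phi>, \<phi>\<^sup>*] = \<delta>\<close> into \<open>[d, u] = \<delta>\<close>; they cancel
  in the hops, where \<open>p\<close> and \<open>q\<close> have opposite parity.

  The supercharge \<open>Q = \<Sum>\<^sub>r u\<^sub>F r \<otimes> d\<^sub>B r\<close> satisfies \<open>Q\<^sup>2 = 0\<close>, annihilates both vacua, and
  \<open>E\<^sub>p\<^sub>q \<otimes> 1 + 1 \<otimes> E\<^sub>p\<^sub>q\<close> is its anticommutator with \<open>d\<^sub>F q \<otimes> u\<^sub>B p\<close> (\<open>total_hop_eq_anticommutator\<close>).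
  So every nonempty product of total hops has vacuum expectation value \<open>0\<close>. Since
  \<open>exp(xE) \<otimes> exp(xE) = exp(x(E \<otimes> 1 + 1 \<otimes> E))\<close>, only the constant term of the combined expectation
  value survives (\<open>vev_CB_mult_eq_1\<close>).

  No tensor product is constructed: operators on \<open>V \<otimes> W\<close> act by transposition, hence from the right, on
  bilinear forms \<open>V \<Rightarrow> W \<Rightarrow> K\<close>. The argument is run for finite partial products, where \<open>Q\<close> is a finite
  sum. The infinite products are reached at the end: each coefficient of an expectation value is
  already attained by all long enough partial products (\<open>eventually_vev_CB\<close>).
\<close>

section \<open>Products and exponentials of operator-valued series\<close>

definition invariant_set :: "'v set \<Rightarrow> 'v opser \<Rightarrow> bool" where
  "invariant_set S F \<longleftrightarrow> (\<forall>n. \<forall>v\<in>S. F n v \<in> S)"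

lemma opser_mult_one: "opser_mult F opser_one n v = F n v"
  if "\<And>k. F k (0 :: 'v::comm_monoid_add) = 0"
proof -
  have "opser_mult F opser_one n v = (\<Sum>k\<in>{n}. F k (opser_one (n - k) v))"
    unfolding opser_mult_def
    by (rule sum.mono_neutral_right) (auto simp: opser_one_def that)
  then show ?thesis by (simp add: opser_one_def)
qed

lemma opser_one_mult: "opser_mult opser_one F n v = F n (v :: 'v::comm_monoid_add)"
proof -
  have "opser_mult opser_one F n v = (\<Sum>k\<in>{0}. opser_one k (F (n - k) v))"
    unfolding opser_mult_def
    by (rule sum.mono_neutral_right) (auto simp: opser_one_def)
  then show ?thesis by (simp add: opser_one_def)
qed

lemma prod_rightwards_zero:
  assumes "\<And>j n. F j n (0 :: 'v::comm_monoid_add) = 0"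
  shows "prod_rightwards F K n 0 = 0"
  using assms by (induction K arbitrary: n) (auto simp: opser_one_def opser_mult_def)

context vector_space
begin

lemma invariant_set_one: "subspace S \<Longrightarrow> invariant_set S opser_one"
  by (auto simp: invariant_set_def opser_one_def subspace_0)

lemma invariant_set_mult:
  assumes "subspace S" "invariant_set S F" "invariant_set S G"
  shows "invariant_set S (opser_mult F G)"
  using assms by (auto simp: invariant_set_def opser_mult_def intro!: subspace_sum)

lemma invariant_set_prod:
  assumes "subspace S" "\<And>j. invariant_set S (F j)"
  shows "invariant_set S (prod_rightwards F K)" and "invariant_set S (prod_leftwards F K)"
  using assms by (induction K) (auto intro: invariant_set_one invariant_set_mult)

end

lemma opser_exp_annihilated:
  assumes "vector_space scale" "A 0 = 0" "A v = 0"
  shows "opser_exp scale A n v = opser_one n v"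
proof (cases n)
  case 0
  then show ?thesis
    using vector_space.vector_space_assms(4)[OF assms(1)] by (simp add: opser_exp_def opser_one_def)
next
  case (Suc k)
  interpret vector_space scale by fact
  have "(A ^^ k) 0 = 0" using assms(2) by (induction k) auto
  then show ?thesis using Suc assms by (simp add: opser_exp_def opser_one_def funpow_swap1)
qed

lemma invariant_set_exp:
  assumes "vector_space scale" "module.subspace scale S" "\<And>v. v \<in> S \<Longrightarrow> A v \<in> S"
  shows "invariant_set S (opser_exp scale A)"
proof -
  interpret vector_space scale by fact
  have "(A ^^ n) v \<in> S" if "v \<in> S" for n v
    using that assms(3) by (induction n) auto
  then show ?thesis using assms(2)
    by (auto simp: invariant_set_def opser_exp_def intro: subspace_scale)
qed

section \<open>Passing to the limit in infinite products\<close>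

definition converges_on :: "'v set \<Rightarrow> (nat \<Rightarrow> 'v opser) \<Rightarrow> bool" where
  "converges_on S P \<longleftrightarrow> (\<forall>n. \<forall>v\<in>S. opser_lim P n v \<in> S \<and>
     (\<forall>\<^sub>F K in sequentially. P K n v = opser_lim P n v))"

lemma converges_onI:
  assumes stable: "\<And>n v. v \<in> S \<Longrightarrow> \<exists>J. \<forall>K\<ge>J. P K n v = P J n v"
    and inv: "\<And>K. invariant_set S (P K)"
  shows "converges_on S P"
  unfolding converges_on_def
proof (intro allI ballI)
  fix n v assume v: "v \<in> S"
  obtain J where J: "\<forall>K\<ge>J. P K n v = P J n v" using stable[OF v] by blast
  have ev: "\<forall>\<^sub>F K in sequentially. P K n v = P J n v"
    unfolding eventually_sequentially using J by blast
  have "opser_lim P n v = P J n v"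
    unfolding opser_lim_def
  proof (rule the_equality)
    show "\<forall>\<^sub>F K in sequentially. P K n v = P J n v" by (rule ev)
  next
    fix w assume "\<forall>\<^sub>F K in sequentially. P K n v = w"
    with ev have "\<forall>\<^sub>F K in sequentially. w = P J n v" by eventually_elim simp
    then show "w = P J n v" by simp
  qed
  then show "opser_lim P n v \<in> S \<and> (\<forall>\<^sub>F K in sequentially. P K n v = opser_lim P n v)"
    using ev inv v by (auto simp: invariant_set_def)
qed

definition eventually_equals ::
  "'v set \<Rightarrow> (nat \<Rightarrow> var multiset \<Rightarrow> 'v) \<Rightarrow> (var multiset \<Rightarrow> 'v) \<Rightarrow> bool" where
  "eventually_equals S \<psi> \<chi> \<longleftrightarrow> (\<forall>m. \<chi> m \<in> S \<and> (\<forall>\<^sub>F K in sequentially. \<psi> K m = \<chi> m))"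

context vector_space
begin

text \<open>
  A coefficient of \<open>F(z) \<psi>\<close> involves finitely many coefficients of \<open>\<psi>\<close> and of \<open>F\<close>. The partial products
  need not stabilise uniformly in the vector, but they only have to be compared on the limits of
  these finitely many coefficients.
\<close>

lemma eventually_equals_apply:
  assumes S: "subspace S" and P: "converges_on S P" and \<psi>: "eventually_equals S \<psi> \<chi>"
  shows "eventually_equals S (\<lambda>K. apply_at z (P K) (\<psi> K)) (apply_at z (opser_lim P) \<chi>)"
  unfolding eventually_equals_def
proof (intro allI conjI)
  fix m
  let ?m = "\<lambda>n. m - replicate_mset n z"
  have mem: "\<chi> m' \<in> S" for m' using \<psi> by (simp add: eventually_equals_def)
  show "apply_at z (opser_lim P) \<chi> m \<in> S"
    using P mem by (auto simp: apply_at_def converges_on_def intro!: subspace_sum[OF S])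
  have "\<forall>\<^sub>F K in sequentially. \<forall>n\<in>{..count m z}.
      \<psi> K (?m n) = \<chi> (?m n) \<and> P K n (\<chi> (?m n)) = opser_lim P n (\<chi> (?m n))"
    using P \<psi> mem
    by (intro eventually_ball_finite eventually_conj ballI)
       (auto simp: eventually_equals_def converges_on_def)
  then show "\<forall>\<^sub>F K in sequentially. apply_at z (P K) (\<psi> K) m = apply_at z (opser_lim P) \<chi> m"
    by eventually_elim (auto simp: apply_at_def intro!: sum.cong)
qed

lemma eventually_equals_foldr:
  assumes "subspace S" "converges_on S P" "eventually_equals S \<psi> \<chi>"
  shows "eventually_equals S (\<lambda>K. foldr (\<lambda>k. apply_at (z k) (P K)) ks (\<psi> K))
           (foldr (\<lambda>k. apply_at (z k) (opser_lim P)) ks \<chi>)"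
  using assms(3) by (induction ks) (auto intro: eventually_equals_apply assms(1,2))

lemma eventually_vev_CB:
  assumes S: "subspace S" "vac \<in> S" and P: "converges_on S P" and R: "converges_on S R"
  shows "\<forall>\<^sub>F K in sequentially. mps_coeff (vev_CB (P K) (R K) vac bra N) m
           = mps_coeff (vev_CB (opser_lim P) (opser_lim R) vac bra N) m"
proof -
  have "eventually_equals S (\<lambda>_. const_vec vac) (const_vec vac)"
    using S subspace_0 by (auto simp: eventually_equals_def const_vec_def)
  then have "eventually_equals S
     (\<lambda>K. foldr (\<lambda>k. apply_at (X k) (P K)) (rev [1..<Suc N])
       (foldr (\<lambda>k. apply_at (Y k) (R K)) [1..<Suc N] (const_vec vac)))
     (foldr (\<lambda>k. apply_at (X k) (opser_lim P)) (rev [1..<Suc N])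
       (foldr (\<lambda>k. apply_at (Y k) (opser_lim R)) [1..<Suc N] (const_vec vac)))"
    by (intro eventually_equals_foldr S P R)
  then have "\<forall>\<^sub>F K in sequentially.
     foldr (\<lambda>k. apply_at (X k) (P K)) (rev [1..<Suc N])
       (foldr (\<lambda>k. apply_at (Y k) (R K)) [1..<Suc N] (const_vec vac)) m =
     foldr (\<lambda>k. apply_at (X k) (opser_lim P)) (rev [1..<Suc N])
       (foldr (\<lambda>k. apply_at (Y k) (opser_lim R)) [1..<Suc N] (const_vec vac)) m"
    by (simp add: eventually_equals_def)
  then show ?thesis
    unfolding vev_CB_def mps_coeff_simps by eventually_elim (rule arg_cong)
qed

end

section \<open>Oscillators of either statistics\<close>

text \<open>
  The statistics sign \<open>s\<close> is \<open>-1\<close> for fermions and \<open>1\<close> for bosons. In the vacuum the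
  modes \<open>p > 0\<close> cannot be lowered, so they are empty; the modes \<open>p \<le> 0\<close> cannot be raised, as in the
  filled Dirac sea of the fermions, and are called the sea for both statistics.
\<close>

locale oscillators = vector_space scale
  for scale :: "'a::field_char_0 \<Rightarrow> 'v::ab_group_add \<Rightarrow> 'v" +
  fixes s :: 'a and u d :: "int \<Rightarrow> 'v \<Rightarrow> 'v" and vac :: 'v and bra :: "'v \<Rightarrow> 'a"
  assumes s_square: "s * s = 1"
    and linear_u: "Vector_Spaces.linear scale scale (u p)"
    and linear_d: "Vector_Spaces.linear scale scale (d p)"
    and linear_bra: "Vector_Spaces.linear scale (*) bra"
    and d_u: "d q (u p v) = scale s (u p (d q v)) + (if p = q then v else 0)"
    and u_u: "u p (u q v) = scale s (u q (u p v))"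
    and d_d: "d p (d q v) = scale s (d q (d p v))"
    and d_vac: "q > 0 \<Longrightarrow> d q vac = 0"
    and u_vac: "p \<le> 0 \<Longrightarrow> u p vac = 0"
    and bra_u: "p > 0 \<Longrightarrow> bra (u p v) = 0"
    and bra_d: "q \<le> 0 \<Longrightarrow> bra (d q v) = 0"
    and bra_vac: "bra vac = 1"
begin

lemmas u_simps [simp] =
  module_hom.add [OF linear_u [folded module_hom_iff_linear]]
  module_hom.scale [OF linear_u [folded module_hom_iff_linear]]
  module_hom.zero [OF linear_u [folded module_hom_iff_linear]]

lemmas d_simps [simp] =
  module_hom.add [OF linear_d [folded module_hom_iff_linear]]
  module_hom.scale [OF linear_d [folded module_hom_iff_linear]]
  module_hom.zero [OF linear_d [folded module_hom_iff_linear]]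

lemmas bra_simps [simp] =
  module_hom.add [OF linear_bra [folded module_hom_iff_linear]]
  module_hom.scale [OF linear_bra [folded module_hom_iff_linear]]
  module_hom.zero [OF linear_bra [folded module_hom_iff_linear]]

definition hop :: "int \<Rightarrow> int \<Rightarrow> 'v \<Rightarrow> 'v" where
  "hop p q v = u p (d q v)"

lemma hop_zero [simp]: "hop p q 0 = 0"
  by (simp add: hop_def)

text \<open>Vectors whose sea is undisturbed below level \<open>h\<close>.\<close>

definition deep :: "int \<Rightarrow> 'v set" where
  "deep h = {v. \<forall>r<h. u r v = 0}"

lemma subspace_deep: "subspace (deep h)"
  by (rule subspaceI) (auto simp: deep_def)

lemma deep_antimono: "h \<le> h' \<Longrightarrow> deep h' \<subseteq> deep h"
  by (auto simp: deep_def)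

lemma u_d: "u p (d q v) = scale s (d q (u p v)) - (if p = q then scale s v else 0)"
  by (simp add: d_u s_square scale_right_distrib)

lemma u_hop_deep:
  assumes "v \<in> deep h" "r < h"
  shows "u r (hop p q v) = (if r = q then - u p v else 0)"
proof -
  have "u r v = 0" using assms by (auto simp: deep_def)
  then have "u r (d q v) = (if r = q then - scale s v else 0)"
    using u_d[of r q v] by simp
  moreover have "u p (- scale s v) = - scale s (u p v)"
    using u_simps(2)[of p "- s" v] by simp
  ultimately show ?thesis
    by (simp add: hop_def u_u[of r p] s_square)
qed

text \<open>Nothing can hop into the undisturbed part of the sea.\<close>

lemma hop_eq_0_deep:
  assumes "v \<in> deep h" "p < h" "p \<noteq> q"
  shows "hop p q v = 0"
  using assms u_d[of p q v] by (simp add: hop_def deep_def)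

text \<open>
  A downward hop out of mode \<open>q < h\<close> has its target in the undisturbed sea too, so it vanishes; hence
  \<open>h\<close> is preserved however many hops are made. Without \<open>p \<le> q\<close> the level drops at worst to \<open>q\<close>.
\<close>

lemma hop_down_deep:
  assumes v: "v \<in> deep h" and "p \<le> q"
  shows "hop p q v \<in> deep h"
proof -
  have "u r (hop p q v) = 0" if "r < h" for r
    using u_hop_deep[OF v that, of p q] v assms(2) that by (auto simp: deep_def)
  then show ?thesis by (simp add: deep_def)
qed

lemma hop_deep:
  assumes v: "v \<in> deep h"
  shows "hop p q v \<in> deep (min h q)"
proof -
  have "u r (hop p q v) = 0" if "r < min h q" for r
    using u_hop_deep[OF v, of r p q] that by simp
  then show ?thesis by (simp add: deep_def)
qed

text \<open>
  A common domain for all the operators, on which the infinite products make sense: it contains the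
  vacuum and is invariant under every hop.
\<close>

definition settled :: "'v set" where
  "settled = (\<Union>h. deep h)"

lemma vac_settled: "vac \<in> settled"
  using u_vac by (auto simp: settled_def deep_def intro: exI[of _ 1])

lemma subspace_settled: "subspace settled"
proof (rule subspaceI)
  show "0 \<in> settled" by (simp add: settled_def deep_def)
next
  fix x y assume "x \<in> settled" "y \<in> settled"
  then obtain h k where "x \<in> deep h" "y \<in> deep k" by (auto simp: settled_def)
  then have "x \<in> deep (min h k)" "y \<in> deep (min h k)"
    using deep_antimono[of "min h k" h] deep_antimono[of "min h k" k] by auto
  then show "x + y \<in> settled"
    by (auto simp: settled_def intro: subspace_add[OF subspace_deep])
next
  fix a x assume "x \<in> settled"
  then show "scale a x \<in> settled"
    by (auto simp: settled_def intro: subspace_scale[OF subspace_deep])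
qed

abbreviation hop_exp :: "int \<Rightarrow> int \<Rightarrow> 'v opser" where
  "hop_exp p q \<equiv> opser_exp scale (hop p q)"

lemma hop_exp_zero [simp]: "hop_exp p q n 0 = 0"
  by (simp add: opser_exp_annihilated vector_space_axioms opser_one_def)

lemma hop_exp_deep:
  assumes "v \<in> deep h" "p < h" "p \<noteq> q"
  shows "hop_exp p q n v = opser_one n v"
  using hop_eq_0_deep[OF assms] by (simp add: opser_exp_annihilated vector_space_axioms)

lemma invariant_hop_exp_settled: "invariant_set settled (hop_exp p q)"
  by (intro invariant_set_exp vector_space_axioms subspace_settled)
     (auto simp: settled_def dest: hop_deep)

text \<open>
  The partial products of \<open>B\<close> and \<open>C\<close>, and of their bosonic counterparts, with the factors
  in the order of their numbering from \<open>M\<close> downwards.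
\<close>

definition hop_chain_up :: "int \<Rightarrow> nat \<Rightarrow> 'v opser" where
  "hop_chain_up M = prod_rightwards (\<lambda>j. hop_exp (M - int j) (M - int j - 1))"

definition hop_chain_down :: "int \<Rightarrow> nat \<Rightarrow> 'v opser" where
  "hop_chain_down M = prod_leftwards (\<lambda>j. hop_exp (M - int j - 1) (M - int j))"

text \<open>
  In the upward chain the later factors act first, directly on \<open>v\<close>, and deep enough ones fix it.
\<close>

lemma converges_hop_chain_up: "converges_on settled (hop_chain_up M)"
proof (rule converges_onI)
  show "invariant_set settled (hop_chain_up M K)" for K
    unfolding hop_chain_up_def
    by (intro invariant_set_prod invariant_hop_exp_settled subspace_settled)
next
  fix n v assume "v \<in> settled"
  then obtain h where v: "v \<in> deep h" by (auto simp: settled_def)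
  define J where "J = nat (M - h + 1)"
  have "hop_chain_up M K n v = hop_chain_up M J n v" if "J \<le> K" for K
    using that
  proof (induction K rule: dec_induct)
    case (step K)
    have "hop_exp (M - int K) (M - int K - 1) k v = opser_one k v" for k
      using step(1) by (intro hop_exp_deep[OF v]) (auto simp: J_def)
    then have "hop_chain_up M (Suc K) n v = opser_mult (hop_chain_up M K) opser_one n v"
      by (simp add: hop_chain_up_def opser_mult_def)
    also have "\<dots> = hop_chain_up M K n v"
      by (rule opser_mult_one) (simp add: hop_chain_up_def prod_rightwards_zero)
    finally show ?case using step by simp
  qed simp
  then show "\<exists>J. \<forall>K\<ge>J. hop_chain_up M K n v = hop_chain_up M J n v" by blast
qed

text \<open>
  In the downward chain a later factor acts on a vector that the previous factors have already
  changed. It is trivial because downward hops do not lower the level of the undisturbed sea.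
\<close>

lemma converges_hop_chain_down: "converges_on settled (hop_chain_down M)"
proof (rule converges_onI)
  show "invariant_set settled (hop_chain_down M K)" for K
    unfolding hop_chain_down_def
    by (intro invariant_set_prod invariant_hop_exp_settled subspace_settled)
next
  fix n v assume "v \<in> settled"
  then obtain h where v: "v \<in> deep h" by (auto simp: settled_def)
  have inv: "invariant_set (deep h) (hop_chain_down M K)" for K
    unfolding hop_chain_down_def
    by (intro invariant_set_prod invariant_set_exp subspace_deep vector_space_axioms)
       (auto intro: hop_down_deep)
  define J where "J = nat (M - h + 1)"
  have "hop_chain_down M K n v = hop_chain_down M J n v" if "J \<le> K" for K
    using that
  proof (induction K rule: dec_induct)
    case (step K)
    have "hop_exp (M - int K - 1) (M - int K) k (hop_chain_down M K l v)
        = opser_one k (hop_chain_down M K l v)" for k l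
      using step(1) v inv[of K]
      by (intro hop_exp_deep[of _ h]) (auto simp: J_def invariant_set_def)
    then have "hop_chain_down M (Suc K) n v = opser_mult opser_one (hop_chain_down M K) n v"
      by (simp add: hop_chain_down_def opser_mult_def)
    also have "\<dots> = hop_chain_down M K n v" by (rule opser_one_mult)
    finally show ?case using step by simp
  qed simp
  then show "\<exists>J. \<forall>K\<ge>J. hop_chain_down M K n v = hop_chain_down M J n v" by blast
qed

end

section \<open>The supersymmetry of a boson-fermion pair\<close>

text \<open>
  The sum over all modes in the supercharge is cut off to a finite set \<open>R\<close>, which only has to contain
  the modes involved in the hops under consideration.
\<close>

locale boson_fermion_pair =
  F: oscillators scaleF "-1" uF dF vacF braF + B: oscillators scaleB 1 uB dB vacB braB
  for scaleF :: "'a::field_char_0 \<Rightarrow> 'v::ab_group_add \<Rightarrow> 'v" and uF dF vacF braF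
    and scaleB :: "'a \<Rightarrow> 'w::ab_group_add \<Rightarrow> 'w" and uB dB vacB braB +
  fixes R :: "int set"
  assumes finite_R: "finite R"
begin

definition bilinear_form :: "('v \<Rightarrow> 'w \<Rightarrow> 'a) \<Rightarrow> bool" where
  "bilinear_form \<Phi> \<longleftrightarrow>
     (\<forall>w. Vector_Spaces.linear scaleF (*) (\<lambda>v. \<Phi> v w)) \<and>
     (\<forall>v. Vector_Spaces.linear scaleB (*) (\<Phi> v))"

lemma vector_space_times: "vector_space ((*) :: 'a \<Rightarrow> 'a \<Rightarrow> 'a)"
  by unfold_locales (auto simp: algebra_simps)

lemma bilinear_form_iff:
  "bilinear_form \<Phi> \<longleftrightarrow>
     (\<forall>v v' w. \<Phi> (v + v') w = \<Phi> v w + \<Phi> v' w) \<and> (\<forall>a v w. \<Phi> (scaleF a v) w = a * \<Phi> v w) \<and>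
     (\<forall>v w w'. \<Phi> v (w + w') = \<Phi> v w + \<Phi> v w') \<and> (\<forall>a v w. \<Phi> v (scaleB a w) = a * \<Phi> v w)"
  using vector_space_times F.vector_space_axioms B.vector_space_axioms
  by (auto simp: bilinear_form_def Vector_Spaces.linear_iff)

lemma bilinear_form_simps:
  assumes "bilinear_form \<Phi>"
  shows "\<Phi> (v + v') w = \<Phi> v w + \<Phi> v' w" "\<Phi> (scaleF a v) w = a * \<Phi> v w"
    "\<Phi> v (w + w') = \<Phi> v w + \<Phi> v w'" "\<Phi> v (scaleB a w) = a * \<Phi> v w"
    "\<Phi> 0 w = 0" "\<Phi> v 0 = 0"
  using assms bilinear_form_iff module_hom.zero unfolding bilinear_form_def module_hom_iff_linear[symmetric]
  by blast+

lemma bilinear_form_sum: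
  assumes "bilinear_form \<Phi>"
  shows "\<Phi> (sum f A) w = (\<Sum>i\<in>A. \<Phi> (f i) w)" "\<Phi> v (sum g A) = (\<Sum>i\<in>A. \<Phi> v (g i))"
  using assms module_hom.sum unfolding bilinear_form_def module_hom_iff_linear[symmetric]
  by blast+

text \<open>
  The transposes of \<open>Q\<close>, of \<open>d\<^sub>F q \<otimes> u\<^sub>B p\<close> and of \<open>E\<^sub>p\<^sub>q \<otimes> 1 + 1 \<otimes> E\<^sub>p\<^sub>q\<close>.
\<close>

definition susy :: "('v \<Rightarrow> 'w \<Rightarrow> 'a) \<Rightarrow> 'v \<Rightarrow> 'w \<Rightarrow> 'a" where
  "susy \<Phi> v w = (\<Sum>r\<in>R. \<Phi> (uF r v) (dB r w))"

definition cosusy :: "int \<Rightarrow> int \<Rightarrow> ('v \<Rightarrow> 'w \<Rightarrow> 'a) \<Rightarrow> 'v \<Rightarrow> 'w \<Rightarrow> 'a" where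
  "cosusy p q \<Phi> v w = \<Phi> (dF q v) (uB p w)"

definition total_hop :: "int \<Rightarrow> int \<Rightarrow> ('v \<Rightarrow> 'w \<Rightarrow> 'a) \<Rightarrow> 'v \<Rightarrow> 'w \<Rightarrow> 'a" where
  "total_hop p q \<Phi> v w = \<Phi> (F.hop p q v) w + \<Phi> v (B.hop p q w)"

lemma bilinear_susy: "bilinear_form \<Phi> \<Longrightarrow> bilinear_form (susy \<Phi>)"
  unfolding bilinear_form_iff susy_def by (simp add: sum.distrib sum_distrib_left)

lemma bilinear_cosusy: "bilinear_form \<Phi> \<Longrightarrow> bilinear_form (cosusy p q \<Phi>)"
  unfolding bilinear_form_iff cosusy_def by simp

text \<open>
  Expanding the anticommutator, the quartic terms cancel because the fermionic reordering has sign
  \<open>-1\<close> and the bosonic one sign \<open>1\<close>. The two contractions, at \<open>r = p\<close> for bosons and \<open>r = q\<close> for fermions,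
  leave the two summands of the total hop.
\<close>

lemma total_hop_eq_anticommutator:
  assumes \<Phi>: "bilinear_form \<Phi>" and "p \<in> R" "q \<in> R"
  shows "total_hop p q \<Phi> v w = cosusy p q (susy \<Phi>) v w + susy (cosusy p q \<Phi>) v w"
proof -
  note simps = bilinear_form_simps[OF \<Phi>]
  have fermi: "\<Phi> (dF q (uF r v)) x = (if r = q then \<Phi> v x else 0) - \<Phi> (uF r (dF q v)) x" for r x
    using simps(2)[of "- 1"] by (auto simp: F.d_u simps simp del: F.scale_minus_left)
  have bose: "\<Phi> x (dB r (uB p w)) = \<Phi> x (uB p (dB r w)) + (if r = p then \<Phi> x w else 0)" for r x
    by (simp add: B.d_u simps)
  have "cosusy p q (susy \<Phi>) v w + susy (cosusy p q \<Phi>) v w =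
      (\<Sum>r\<in>R. (if r = p then \<Phi> (uF r (dF q v)) w else 0) + (if r = q then \<Phi> v (uB p (dB r w)) else 0))"
    unfolding cosusy_def susy_def sum.distrib [symmetric]
    by (intro sum.cong refl) (auto simp: fermi bose)
  also have "\<dots> = total_hop p q \<Phi> v w"
    using assms finite_R
    by (simp add: sum.distrib sum.delta total_hop_def F.hop_def B.hop_def)
  finally show ?thesis ..
qed

text \<open>
  The summands of \<open>Q\<^sup>2\<close> are antisymmetric in the two modes: exchanging them costs a sign on the
  fermionic side and none on the bosonic side.
\<close>

lemma susy_susy:
  assumes \<Phi>: "bilinear_form \<Phi>"
  shows "susy (susy \<Phi>) v w = 0"
proof -
  define S where "S = (\<Sum>r\<in>R. \<Sum>t\<in>R. \<Phi> (uF t (uF r v)) (dB t (dB r w)))"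
  have "S = (\<Sum>t\<in>R. \<Sum>r\<in>R. \<Phi> (uF t (uF r v)) (dB t (dB r w)))"
    unfolding S_def by (rule sum.swap)
  also have "\<dots> = (\<Sum>t\<in>R. \<Sum>r\<in>R. - \<Phi> (uF r (uF t v)) (dB r (dB t w)))"
  proof (intro sum.cong refl)
    fix t r
    have "\<Phi> (uF t (uF r v)) (dB t (dB r w)) = \<Phi> (scaleF (- 1) (uF r (uF t v))) (dB r (dB t w))"
      using F.u_u[of t r v] B.d_d[of t r w] by simp
    then show "\<Phi> (uF t (uF r v)) (dB t (dB r w)) = - \<Phi> (uF r (uF t v)) (dB r (dB t w))"
      using bilinear_form_simps(2)[OF \<Phi>, of "- 1"] by simp
  qed
  also have "\<dots> = - S" by (simp add: S_def sum_negf)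
  finally have "S + S = 0" by (metis add.left_inverse)
  then have "S = 0" by (simp flip: mult_2)
  then show ?thesis by (simp add: susy_def S_def)
qed

definition closed_form :: "('v \<Rightarrow> 'w \<Rightarrow> 'a) \<Rightarrow> bool" where
  "closed_form \<Phi> \<longleftrightarrow> bilinear_form \<Phi> \<and> (\<forall>v w. susy \<Phi> v w = 0)"

definition exact_form :: "('v \<Rightarrow> 'w \<Rightarrow> 'a) \<Rightarrow> bool" where
  "exact_form \<Phi> \<longleftrightarrow> (\<exists>\<Psi>. bilinear_form \<Psi> \<and> \<Phi> = susy \<Psi>)"

lemma exact_imp_closed: "exact_form \<Phi> \<Longrightarrow> closed_form \<Phi>"
  by (auto simp: exact_form_def closed_form_def bilinear_susy susy_susy)

lemma exact_form_zero: "exact_form (\<lambda>_ _. 0)"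
  unfolding exact_form_def by (rule exI[of _ "\<lambda>_ _. 0"]) (auto simp: bilinear_form_iff susy_def fun_eq_iff)

lemma exact_form_add:
  assumes "exact_form \<Phi>" "exact_form \<Psi>"
  shows "exact_form (\<lambda>v w. \<Phi> v w + \<Psi> v w)"
proof -
  obtain \<Phi>' \<Psi>' where *: "bilinear_form \<Phi>'" "bilinear_form \<Psi>'" "\<Phi> = susy \<Phi>'" "\<Psi> = susy \<Psi>'"
    using assms by (auto simp: exact_form_def)
  show ?thesis unfolding exact_form_def
    by (rule exI[of _ "\<lambda>v w. \<Phi>' v w + \<Psi>' v w"])
       (use * in \<open>auto simp: bilinear_form_iff susy_def fun_eq_iff sum.distrib algebra_simps\<close>)
qed

lemma exact_form_scale:
  assumes "exact_form \<Phi>"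
  shows "exact_form (\<lambda>v w. a * \<Phi> v w)"
proof -
  obtain \<Phi>' where *: "bilinear_form \<Phi>'" "\<Phi> = susy \<Phi>'"
    using assms by (auto simp: exact_form_def)
  show ?thesis unfolding exact_form_def
    by (rule exI[of _ "\<lambda>v w. a * \<Phi>' v w"])
       (use * in \<open>auto simp: bilinear_form_iff susy_def fun_eq_iff sum_distrib_left algebra_simps\<close>)
qed

lemma exact_form_sum:
  assumes "\<And>i. i \<in> A \<Longrightarrow> exact_form (\<Phi> i)"
  shows "exact_form (\<lambda>v w. \<Sum>i\<in>A. \<Phi> i v w)"
  using assms
proof (induction A rule: infinite_finite_induct)
  case (insert i A)
  then show ?case using exact_form_add[of "\<Phi> i" "\<lambda>v w. \<Sum>i\<in>A. \<Phi> i v w"] by simp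
qed (simp_all add: exact_form_zero)

text \<open>
  Each summand of \<open>Q\<close> kills the vacuum, through the boson for an empty mode and through the fermion
  for a mode in the sea; on the dual vacuum the roles are exchanged.
\<close>

lemma exact_form_vac:
  assumes "exact_form \<Phi>"
  shows "\<Phi> vacF vacB = 0"
proof -
  obtain \<Psi> where \<Psi>: "bilinear_form \<Psi>" "\<Phi> = susy \<Psi>"
    using assms by (auto simp: exact_form_def)
  have "\<Psi> (uF r vacF) (dB r vacB) = 0" for r
    using F.u_vac[of r] B.d_vac[of r] bilinear_form_simps(5,6)[OF \<Psi>(1)] by (cases "r > 0") auto
  then show ?thesis by (simp add: \<Psi>(2) susy_def)
qed

lemma closed_bra_product: "closed_form (\<lambda>v w. braF v * braB w)"
proof -
  have "braF (uF r v) * braB (dB r w) = 0" for r v w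
    using F.bra_u[of r v] B.bra_d[of r w] by (cases "r > 0") auto
  then have "susy (\<lambda>v w. braF v * braB w) v w = 0" for v w
    unfolding susy_def by (intro sum.neutral ballI)
  then show ?thesis
    by (simp add: closed_form_def bilinear_form_iff algebra_simps)
qed

lemma exact_total_hop:
  assumes "closed_form \<Phi>" "p \<in> R" "q \<in> R"
  shows "exact_form (total_hop p q \<Phi>)"
  unfolding exact_form_def
proof (intro exI conjI ext)
  show "bilinear_form (cosusy p q \<Phi>)"
    using assms by (simp add: closed_form_def bilinear_cosusy)
  show "total_hop p q \<Phi> v w = susy (cosusy p q \<Phi>) v w" for v w
    using assms by (simp add: total_hop_eq_anticommutator closed_form_def cosusy_def)
qed

section \<open>Series acting on bilinear forms\<close>

text \<open>
  The transpose of the \<open>n\<close>-th coefficient of \<open>F(x) \<otimes> G(x)\<close>.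
\<close>

definition pull :: "'v opser \<Rightarrow> 'w opser \<Rightarrow> nat \<Rightarrow> ('v \<Rightarrow> 'w \<Rightarrow> 'a) \<Rightarrow> 'v \<Rightarrow> 'w \<Rightarrow> 'a" where
  "pull F G n \<Phi> v w = (\<Sum>k\<le>n. \<Phi> (F k v) (G (n - k) w))"

text \<open>
  On closed forms modulo exact forms the series \<open>F(x) \<otimes> G(x)\<close> acts as the constant \<open>1\<close>.
\<close>

definition homotopic_to_one :: "'v opser \<Rightarrow> 'w opser \<Rightarrow> bool" where
  "homotopic_to_one F G \<longleftrightarrow>
     (\<forall>\<Phi>. closed_form \<Phi> \<longrightarrow> pull F G 0 \<Phi> = \<Phi> \<and> (\<forall>n>0. exact_form (pull F G n \<Phi>)))"

lemma homotopic_one: "homotopic_to_one opser_one opser_one"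
  unfolding homotopic_to_one_def
proof (intro allI impI conjI ext)
  fix \<Phi> assume \<Phi>: "closed_form \<Phi>"
  show "pull opser_one opser_one 0 \<Phi> v w = \<Phi> v w" for v w
    by (simp add: pull_def opser_one_def)
  fix n :: nat assume "n > 0"
  then have "pull opser_one opser_one n \<Phi> v w = 0" for v w
    using \<Phi> unfolding pull_def closed_form_def
    by (intro sum.neutral) (auto simp: opser_one_def bilinear_form_simps)
  then have "pull opser_one opser_one n \<Phi> = (\<lambda>_ _. 0)" by (intro ext)
  then show "exact_form (pull opser_one opser_one n \<Phi>)" using exact_form_zero by simp
qed

text \<open>
  The coefficient of \<open>x\<^sup>n\<close> in the differential equation \<open>d/dx exp(xT) = T exp(xT)\<close> for the total hop
  \<open>T = E\<^sub>p\<^sub>q \<otimes> 1 + 1 \<otimes> E\<^sub>p\<^sub>q\<close>.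
\<close>

lemma pull_exp_Suc:
  assumes \<Phi>: "bilinear_form \<Phi>"
  shows "of_nat (Suc n) * pull (F.hop_exp p q) (B.hop_exp p q) (Suc n) \<Phi> v w
       = pull (F.hop_exp p q) (B.hop_exp p q) n (total_hop p q \<Phi>) v w"
proof -
  let ?A = "F.hop p q" and ?B = "B.hop p q"
  define f where "f k l = inverse (fact k) * inverse (fact l) * \<Phi> ((?A ^^ k) v) ((?B ^^ l) w)" for k l
  have pull: "pull (F.hop_exp p q) (B.hop_exp p q) m \<Phi> v w = (\<Sum>k\<le>m. f k (m - k))" for m
    unfolding pull_def opser_exp_def f_def
    by (simp add: bilinear_form_simps[OF \<Phi>] mult.assoc mult.left_commute)
  \<comment> \<open>Split the factor \<open>n + 1\<close> as \<open>k + (n + 1 - k)\<close>: each part cancels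
    against the matching factorial.\<close>
  have "of_nat (Suc n) * (\<Sum>k\<le>Suc n. f k (Suc n - k)) =
      (\<Sum>k\<le>Suc n. of_nat k * f k (Suc n - k)) + (\<Sum>k\<le>Suc n. of_nat (Suc n - k) * f k (Suc n - k))"
    unfolding sum_distrib_left sum.distrib [symmetric]
    by (intro sum.cong refl) (simp add: of_nat_diff algebra_simps)
  also have "(\<Sum>k\<le>Suc n. of_nat k * f k (Suc n - k)) = (\<Sum>k\<le>n. of_nat (Suc k) * f (Suc k) (n - k))"
    by (subst sum.atMost_Suc_shift) simp
  also have "(\<Sum>k\<le>Suc n. of_nat (Suc n - k) * f k (Suc n - k)) =
      (\<Sum>k\<le>n. of_nat (Suc (n - k)) * f k (Suc (n - k)))"
    by (simp add: Suc_diff_le add_diff_eq)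
  also have "(\<Sum>k\<le>n. of_nat (Suc k) * f (Suc k) (n - k)) + (\<Sum>k\<le>n. of_nat (Suc (n - k)) * f k (Suc (n - k)))
      = pull (F.hop_exp p q) (B.hop_exp p q) n (total_hop p q \<Phi>) v w"
    unfolding pull_def sum.distrib [symmetric]
  proof (intro sum.cong refl)
    fix k
    have fact: "of_nat (Suc j) * inverse (fact (Suc j)) = (inverse (fact j) :: 'a)" for j
      by (simp del: of_nat_Suc)
    have "of_nat (Suc k) * f (Suc k) (n - k) =
        inverse (fact k) * inverse (fact (n - k)) * \<Phi> (?A ((?A ^^ k) v)) ((?B ^^ (n - k)) w)"
      unfolding f_def by (simp only: mult.assoc [symmetric] fact funpow.simps o_apply)
    moreover have "of_nat (Suc (n - k)) * f k (Suc (n - k)) =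
        inverse (fact k) * inverse (fact (n - k)) * \<Phi> ((?A ^^ k) v) (?B ((?B ^^ (n - k)) w))"
      unfolding f_def fact [of "n - k", symmetric] by (simp only: funpow.simps o_apply mult_ac)
    ultimately show "of_nat (Suc k) * f (Suc k) (n - k) + of_nat (Suc (n - k)) * f k (Suc (n - k)) =
        total_hop p q \<Phi> (F.hop_exp p q k v) (B.hop_exp p q (n - k) w)"
      by (simp add: total_hop_def opser_exp_def bilinear_form_simps[OF \<Phi>] F.hop_def B.hop_def
          algebra_simps)
  qed
  finally show ?thesis by (simp only: pull)
qed

lemma homotopic_hop_exp:
  assumes pq: "p \<in> R" "q \<in> R"
  shows "homotopic_to_one (F.hop_exp p q) (B.hop_exp p q)"
proof -
  let ?pull = "pull (F.hop_exp p q) (B.hop_exp p q)"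
  have zero: "?pull 0 \<Phi> = \<Phi>" for \<Phi>
    by (simp add: pull_def opser_exp_def fun_eq_iff)
  have step: "exact_form (?pull (Suc n) \<Phi>)"
    if "closed_form \<Phi>" "exact_form (?pull n (total_hop p q \<Phi>))" for n \<Phi>
  proof -
    have "?pull (Suc n) \<Phi> v w = inverse (of_nat (Suc n)) * ?pull n (total_hop p q \<Phi>) v w" for v w
    proof -
      have \<Phi>: "bilinear_form \<Phi>" using that(1) by (simp add: closed_form_def)
      show ?thesis
        unfolding pull_exp_Suc[OF \<Phi>, symmetric] mult.assoc[symmetric] by (simp del: of_nat_Suc)
    qed
    then have eq: "?pull (Suc n) \<Phi> = (\<lambda>v w. inverse (of_nat (Suc n)) * ?pull n (total_hop p q \<Phi>) v w)"
      by (intro ext)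
    show ?thesis unfolding eq by (rule exact_form_scale[OF that(2)])
  qed
  have exact: "exact_form (?pull n \<Phi>)" if "exact_form \<Phi>" for n \<Phi>
    using that
  proof (induction n arbitrary: \<Phi>)
    case 0
    then show ?case by (simp only: zero)
  next
    case (Suc n)
    have "closed_form \<Phi>" by (rule exact_imp_closed[OF Suc.prems])
    then show ?case using step Suc.IH exact_total_hop pq by blast
  qed
  have "exact_form (?pull n \<Phi>)" if \<Phi>: "closed_form \<Phi>" and "n > 0" for n \<Phi>
  proof -
    obtain k where "n = Suc k" using \<open>n > 0\<close> by (cases n) auto
    then show ?thesis using step[OF \<Phi> exact[OF exact_total_hop[OF \<Phi> pq]]] by simp
  qed
  then show ?thesis by (simp add: homotopic_to_one_def zero)
qed

text \<open>
  Transposition reverses the order, so the left factors \<open>F\<close>, \<open>G\<close> act first on the form.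
\<close>

lemma pull_mult:
  assumes \<Phi>: "bilinear_form \<Phi>"
  shows "pull (opser_mult F F') (opser_mult G G') n \<Phi> v w
       = (\<Sum>j\<le>n. pull F' G' (n - j) (pull F G j \<Phi>) v w)"
proof -
  have "pull (opser_mult F F') (opser_mult G G') n \<Phi> v w =
      (\<Sum>k\<le>n. \<Sum>a\<le>k. \<Sum>b\<le>n - k. \<Phi> (F a (F' (k - a) v)) (G b (G' (n - k - b) w)))"
    unfolding pull_def opser_mult_def
    by (simp add: bilinear_form_sum[OF \<Phi>]) (rule sum.cong [OF refl sum.swap])
  also have "\<dots> = (\<Sum>(k, a, b)\<in>(SIGMA k:{..n}. {..k} \<times> {..n - k}).
      \<Phi> (F a (F' (k - a) v)) (G b (G' (n - k - b) w)))"
    by (simp add: sum.Sigma sum.cartesian_product)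
  also have "\<dots> = (\<Sum>(j, i, a)\<in>(SIGMA j:{..n}. {..n - j} \<times> {..j}).
      \<Phi> (F a (F' i v)) (G (j - a) (G' (n - j - i) w)))"
    by (rule sum.reindex_bij_witness
          [where i = "\<lambda>(j, i, a). (i + a, a, j - a)" and j = "\<lambda>(k, a, b). (a + b, k - a, a)"])
       (auto simp: add.commute)
  also have "\<dots> = (\<Sum>j\<le>n. pull F' G' (n - j) (pull F G j \<Phi>) v w)"
    unfolding pull_def by (simp add: sum.Sigma sum.cartesian_product)
  finally show ?thesis .
qed

lemma homotopic_mult:
  assumes FG: "homotopic_to_one F G" and FG': "homotopic_to_one F' G'"
  shows "homotopic_to_one (opser_mult F F') (opser_mult G G')"
  unfolding homotopic_to_one_def
proof (intro allI impI conjI)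
  fix \<Phi> assume \<Phi>: "closed_form \<Phi>"
  have pull: "pull (opser_mult F F') (opser_mult G G') n \<Phi>
      = (\<lambda>v w. \<Sum>j\<le>n. pull F' G' (n - j) (pull F G j \<Phi>) v w)" for n
    using \<Phi> by (intro ext pull_mult) (simp add: closed_form_def)
  show "pull (opser_mult F F') (opser_mult G G') 0 \<Phi> = \<Phi>"
    using FG FG' \<Phi> by (simp add: pull homotopic_to_one_def)
  fix n :: nat assume n: "n > 0"
  show "exact_form (pull (opser_mult F F') (opser_mult G G') n \<Phi>)"
    unfolding pull
  proof (rule exact_form_sum)
    fix j assume "j \<in> {..n}"
    show "exact_form (pull F' G' (n - j) (pull F G j \<Phi>))"
    proof (cases "j = 0")
      case True
      then show ?thesis using FG FG' \<Phi> n by (simp add: homotopic_to_one_def)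
    next
      case False
      then have "exact_form (pull F G j \<Phi>)" using FG \<Phi> by (simp add: homotopic_to_one_def)
      then show ?thesis
        using FG' exact_imp_closed by (cases "n - j = 0") (auto simp: homotopic_to_one_def)
    qed
  qed
qed

lemma homotopic_prod:
  assumes "\<And>j. j < K \<Longrightarrow> homotopic_to_one (F j) (G j)"
  shows "homotopic_to_one (prod_rightwards F K) (prod_rightwards G K)"
    and "homotopic_to_one (prod_leftwards F K) (prod_leftwards G K)"
  using assms by (induction K) (auto intro: homotopic_one homotopic_mult)

section \<open>Vacuum expectation values of paired series\<close>

text \<open>The form \<open>\<Phi>\<close> extended bilinearly to power series with vector coefficients.\<close>

definition paired ::
  "('v \<Rightarrow> 'w \<Rightarrow> 'a) \<Rightarrow> (var multiset \<Rightarrow> 'v) \<Rightarrow> (var multiset \<Rightarrow> 'w) \<Rightarrow> var multiset \<Rightarrow> 'a" where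
  "paired \<Phi> \<psi> \<chi> m = (\<Sum>(p, q)\<in>splittings m. \<Phi> (\<psi> p) (\<chi> q))"

text \<open>
  The powers \<open>z\<^sup>a\<close> from \<open>F\<close> and \<open>z\<^sup>b\<close> from \<open>G\<close> are collected according to \<open>n = a + b\<close>; what remains is a
  splitting of the monomial \<open>m / z\<^sup>n\<close>.
\<close>

lemma paired_apply_at:
  assumes \<Phi>: "bilinear_form \<Phi>"
  shows "paired \<Phi> (apply_at z F \<psi>) (apply_at z G \<chi>) m
       = (\<Sum>n\<le>count m z. paired (pull F G n \<Phi>) \<psi> \<chi> (m - replicate_mset n z))"
proof -
  let ?r = "\<lambda>n. replicate_mset n z"
  have "paired \<Phi> (apply_at z F \<psi>) (apply_at z G \<chi>) m =
      (\<Sum>(p, q)\<in>splittings m. \<Sum>a\<le>count p z. \<Sum>b\<le>count q z.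
         \<Phi> (F a (\<psi> (p - ?r a))) (G b (\<chi> (q - ?r b))))"
    unfolding paired_def apply_at_def
    by (auto simp: bilinear_form_sum[OF \<Phi>] case_prod_beta intro!: sum.cong sum.swap)
  also have "\<dots> = (\<Sum>(pq, a, b)\<in>(SIGMA pq:splittings m. {..count (fst pq) z} \<times> {..count (snd pq) z}).
      \<Phi> (F a (\<psi> (fst pq - ?r a))) (G b (\<chi> (snd pq - ?r b))))"
    by (simp add: sum.Sigma sum.cartesian_product case_prod_beta)
  also have "\<dots> = (\<Sum>(n, pq, a)\<in>(SIGMA n:{..count m z}. splittings (m - ?r n) \<times> {..n}).
      \<Phi> (F a (\<psi> (fst pq))) (G (n - a) (\<chi> (snd pq))))"
  proof (rule sum.reindex_bij_witness
          [where i = "\<lambda>(n, pq, a). ((fst pq + ?r a, snd pq + ?r (n - a)), a, n - a)"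
            and j = "\<lambda>(pq, a, b). (a + b, (fst pq - ?r a, snd pq - ?r b), a)"], goal_cases)
    case (1 x)
    then show ?case
      by (auto simp: splittings_def count_le_replicate_mset_subset_eq subset_mset.diff_add)
  next
    case (2 x)
    obtain p q a b where x: "x = ((p, q), a, b)" by (metis prod.collapse)
    have le: "?r a \<subseteq># p" "?r b \<subseteq># q" "p + q = m" "a \<le> count p z" "b \<le> count q z"
      using 2 by (auto simp: x splittings_def count_le_replicate_mset_subset_eq)
    have "p - ?r a + (q - ?r b) = m - ?r (a + b)"
      using le by (auto simp: multiset_eq_iff)
    moreover have "a + b \<le> count m z" using le by auto
    ultimately show ?case by (auto simp: x splittings_def)
  next
    case (3 x)
    then show ?case by auto
  next
    case (4 x)
    obtain n p q a where x: "x = (n, (p, q), a)" by (metis prod.collapse)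
    have le: "a \<le> n" "n \<le> count m z" "p + q = m - ?r n"
      using 4 by (auto simp: x splittings_def)
    have "?r n = ?r a + ?r (n - a)"
      using le(1) by (simp add: multiset_eq_iff)
    moreover have "?r n \<subseteq># m" using le by (simp add: count_le_replicate_mset_subset_eq)
    ultimately have "p + ?r a + (q + ?r (n - a)) = m"
      using le(3) by (metis (no_types, lifting) add.assoc add.commute subset_mset.diff_add)
    then show ?case using le by (auto simp: x splittings_def)
  next
    case (5 x)
    then show ?case by auto
  qed
  also have "\<dots> = (\<Sum>n\<le>count m z. paired (pull F G n \<Phi>) \<psi> \<chi> (m - ?r n))"
    unfolding paired_def pull_def
    by (simp add: sum.Sigma sum.cartesian_product case_prod_beta)
  finally show ?thesis .
qed

text \<open>
  No closed form can tell \<open>\<psi> \<otimes> \<chi>\<close> from the product of the two vacua. This property survives the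
  application of a pair of series homotopic to one, as the positive coefficients of the pair turn a
  closed form into an exact one, which vanishes on the vacua.
\<close>

definition vacuum_like :: "(var multiset \<Rightarrow> 'v) \<Rightarrow> (var multiset \<Rightarrow> 'w) \<Rightarrow> bool" where
  "vacuum_like \<psi> \<chi> \<longleftrightarrow>
     (\<forall>\<Phi> m. closed_form \<Phi> \<longrightarrow> paired \<Phi> \<psi> \<chi> m = (if m = {#} then \<Phi> vacF vacB else 0))"

lemma vacuum_like_const: "vacuum_like (const_vec vacF) (const_vec vacB)"
  unfolding vacuum_like_def
proof (intro allI impI)
  fix \<Phi> m assume "closed_form \<Phi>"
  then have \<Phi>: "bilinear_form \<Phi>" by (simp add: closed_form_def)
  have "paired \<Phi> (const_vec vacF) (const_vec vacB) m =
      (\<Sum>pq\<in>splittings m. if pq = ({#}, {#}) then \<Phi> vacF vacB else 0)"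
    unfolding paired_def
  proof (intro sum.cong refl, clarify)
    fix p q :: "var multiset"
    show "\<Phi> (const_vec vacF p) (const_vec vacB q) =
        (if (p, q) = ({#}, {#}) then \<Phi> vacF vacB else 0)"
      by (cases "p = {#}"; cases "q = {#}")
         (simp_all add: const_vec_def bilinear_form_simps[OF \<Phi>])
  qed
  also have "\<dots> = (if m = {#} then \<Phi> vacF vacB else 0)"
    by (simp add: sum.delta) (auto simp: splittings_def)
  finally show "paired \<Phi> (const_vec vacF) (const_vec vacB) m
      = (if m = {#} then \<Phi> vacF vacB else 0)" .
qed

lemma vacuum_like_apply_at:
  assumes FG: "homotopic_to_one F G" and vac: "vacuum_like \<psi> \<chi>"
  shows "vacuum_like (apply_at z F \<psi>) (apply_at z G \<chi>)"
  unfolding vacuum_like_def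
proof (intro allI impI)
  fix \<Phi> m assume \<Phi>: "closed_form \<Phi>"
  have pos: "paired (pull F G n \<Phi>) \<psi> \<chi> m' = 0" if "n > 0" for n m'
  proof -
    have "exact_form (pull F G n \<Phi>)" using FG \<Phi> that by (simp add: homotopic_to_one_def)
    then show ?thesis
      using vac exact_imp_closed exact_form_vac by (auto simp: vacuum_like_def)
  qed
  have "paired \<Phi> (apply_at z F \<psi>) (apply_at z G \<chi>) m =
      (\<Sum>n\<le>count m z. paired (pull F G n \<Phi>) \<psi> \<chi> (m - replicate_mset n z))"
    using \<Phi> by (simp add: paired_apply_at closed_form_def)
  also have "\<dots> = (\<Sum>n\<in>{0}. paired (pull F G n \<Phi>) \<psi> \<chi> (m - replicate_mset n z))"
    by (rule sum.mono_neutral_right) (auto simp: pos)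
  also have "\<dots> = (if m = {#} then \<Phi> vacF vacB else 0)"
    using FG \<Phi> vac by (simp add: homotopic_to_one_def vacuum_like_def)
  finally show "paired \<Phi> (apply_at z F \<psi>) (apply_at z G \<chi>) m
      = (if m = {#} then \<Phi> vacF vacB else 0)" .
qed

lemma vacuum_like_foldr:
  assumes "homotopic_to_one F G" "vacuum_like \<psi> \<chi>"
  shows "vacuum_like (foldr (\<lambda>k. apply_at (z k) F) ks \<psi>) (foldr (\<lambda>k. apply_at (z k) G) ks \<chi>)"
  using assms by (induction ks) (auto intro: vacuum_like_apply_at)

lemma vev_CB_mult_eq_1:
  assumes "homotopic_to_one C C'" "homotopic_to_one B B'"
  shows "vev_CB C B vacF braF N * vev_CB C' B' vacB braB N = 1"
proof -
  let ?\<psi> = "foldr (\<lambda>k. apply_at (X k) C) (rev [1..<Suc N])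
      (foldr (\<lambda>k. apply_at (Y k) B) [1..<Suc N] (const_vec vacF))"
  let ?\<chi> = "foldr (\<lambda>k. apply_at (X k) C') (rev [1..<Suc N])
      (foldr (\<lambda>k. apply_at (Y k) B') [1..<Suc N] (const_vec vacB))"
  have "vacuum_like ?\<psi> ?\<chi>" by (intro vacuum_like_foldr vacuum_like_const assms)
  then have "paired (\<lambda>v w. braF v * braB w) ?\<psi> ?\<chi> m = (if m = {#} then 1 else 0)" for m
    using closed_bra_product by (auto simp: vacuum_like_def F.bra_vac B.bra_vac)
  then show ?thesis
    by (simp add: mps_eq_iff times_mps.rep_eq one_mps.rep_eq paired_def vev_CB_def)
qed

end

text \<open>
  A coefficient of the product of two power series depends on finitely many coefficients of the
  factors, so it suffices that the identity holds for the partial products of every length \<open>K\<close>.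
\<close>

lemma vev_CB_hop_chains:
  assumes F: "oscillators scaleF (- 1) uF dF vacF braF"
    and B: "oscillators scaleB 1 uB dB vacB braB"
  shows "vev_CB (opser_lim (oscillators.hop_chain_down scaleF uF dF M))
            (opser_lim (oscillators.hop_chain_up scaleF uF dF M)) vacF braF N *
         vev_CB (opser_lim (oscillators.hop_chain_down scaleB uB dB M))
            (opser_lim (oscillators.hop_chain_up scaleB uB dB M)) vacB braB N = 1"
    (is "?f * ?g = 1")
proof -
  interpret F: oscillators scaleF "- 1" uF dF vacF braF by fact
  interpret B: oscillators scaleB 1 uB dB vacB braB by fact
  define f where "f K = vev_CB (F.hop_chain_down M K) (F.hop_chain_up M K) vacF braF N" for K
  define g where "g K = vev_CB (B.hop_chain_down M K) (B.hop_chain_up M K) vacB braB N" for K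
  have fg: "f K * g K = 1" for K
  proof -
    \<comment> \<open>The first \<open>K\<close> factors hop between modes from \<open>M - K\<close> to \<open>M\<close>.\<close>
    interpret boson_fermion_pair scaleF uF dF vacF braF scaleB uB dB vacB braB "{M - int K..M}"
      by unfold_locales simp
    show ?thesis
      unfolding f_def g_def F.hop_chain_down_def F.hop_chain_up_def B.hop_chain_down_def
        B.hop_chain_up_def
      by (intro vev_CB_mult_eq_1 homotopic_prod homotopic_hop_exp) auto
  qed
  have f: "\<forall>\<^sub>F K in sequentially. mps_coeff (f K) m = mps_coeff ?f m" for m
    unfolding f_def
    by (intro F.eventually_vev_CB[OF F.subspace_settled F.vac_settled] F.converges_hop_chain_up
        F.converges_hop_chain_down)
  have g: "\<forall>\<^sub>F K in sequentially. mps_coeff (g K) m = mps_coeff ?g m" for m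
    unfolding g_def
    by (intro B.eventually_vev_CB[OF B.subspace_settled B.vac_settled] B.converges_hop_chain_up
        B.converges_hop_chain_down)
  have "mps_coeff (?f * ?g) m = mps_coeff 1 m" for m
  proof -
    have "\<forall>\<^sub>F K in sequentially. \<forall>(p, q)\<in>splittings m.
        mps_coeff (f K) p = mps_coeff ?f p \<and> mps_coeff (g K) q = mps_coeff ?g q"
      by (intro eventually_ball_finite ballI) (auto intro: eventually_conj f g)
    then have "\<forall>\<^sub>F K in sequentially. mps_coeff (f K * g K) m = mps_coeff (?f * ?g) m"
      by eventually_elim (auto simp: times_mps.rep_eq intro!: sum.cong)
    then show ?thesis by (simp add: fg)
  qed
  then show ?thesis by (simp add: mps_eq_iff)
qed

section \<open>The two systems as oscillators\<close>

lemma (in bc_fermions) oscillators_bc: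
  "oscillators scale (- 1) (\<lambda>p. b (1 - p)) (\<lambda>q. c (q - 1)) vac bra"
proof (intro oscillators.intro oscillators_axioms.intro vector_space_axioms
    linear_b linear_c linear_bra bra_vac)
  fix p q v
  show "c (q - 1) (b (1 - p) v) = scale (- 1) (b (1 - p) (c (q - 1) v)) + (if p = q then v else 0)"
    using anticomm_bc[of "1 - p" "q - 1" v] by (auto simp: algebra_simps)
  show "b (1 - p) (b (1 - q) v) = scale (- 1) (b (1 - q) (b (1 - p) v))"
    using anticomm_bb[of "1 - p" "1 - q" v] by (simp add: eq_neg_iff_add_eq_0)
  show "c (p - 1) (c (q - 1) v) = scale (- 1) (c (q - 1) (c (p - 1) v))"
    using anticomm_cc[of "p - 1" "q - 1" v] by (simp add: eq_neg_iff_add_eq_0)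
  show "c (q - 1) vac = 0" if "q > 0" using that by (simp add: c_vac)
  show "b (1 - p) vac = 0" if "p \<le> 0" using that b_vac[of "- p"] by (simp add: algebra_simps)
  show "bra (b (1 - p) v) = 0" if "p > 0" using that bra_b[of "- p"] by (simp add: algebra_simps)
  show "bra (c (q - 1) v) = 0" if "q \<le> 0" using that by (simp add: bra_c)
qed simp

definition alternating :: "int \<Rightarrow> 'v::ab_group_add \<Rightarrow> 'v" where
  "alternating p v = (if even p then v else - v)"

lemma (in charged_bosons) oscillators_phi:
  "oscillators scale 1 (\<lambda>p v. alternating p (\<phi> (- p) v)) (\<lambda>q v. alternating (q + 1) (\<phi>s q v)) vac bra"
proof -
  have linear_alternating: "Vector_Spaces.linear scale scale (\<lambda>v. alternating p (f v))"
    if "Vector_Spaces.linear scale scale f" for p f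
    using that by (auto simp: alternating_def Vector_Spaces.linear_iff)
  have neg: "\<phi> i (- v) = - \<phi> i v" "\<phi>s i (- v) = - \<phi>s i v" "bra (- v) = - bra v" for i v
    using linear_phi linear_phis linear_bra module_hom.neg
    unfolding module_hom_iff_linear[symmetric] by blast+
  show ?thesis
  proof (intro oscillators.intro oscillators_axioms.intro vector_space_axioms linear_alternating
      linear_phi linear_phis linear_bra bra_vac)
    fix p q v
    show "alternating (q + 1) (\<phi>s q (alternating p (\<phi> (- p) v))) =
        scale 1 (alternating p (\<phi> (- p) (alternating (q + 1) (\<phi>s q v)))) + (if p = q then v else 0)"
      using comm_phi_phis[of "- p" q v] by (auto simp: alternating_def neg algebra_simps)
    show "alternating p (\<phi> (- p) (alternating q (\<phi> (- q) v))) =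
        scale 1 (alternating q (\<phi> (- q) (alternating p (\<phi> (- p) v))))"
      using comm_phi_phi[of "- p" "- q" v] by (simp add: alternating_def neg)
    show "alternating (p + 1) (\<phi>s p (alternating (q + 1) (\<phi>s q v))) =
        scale 1 (alternating (q + 1) (\<phi>s q (alternating (p + 1) (\<phi>s p v))))"
      using comm_phis_phis[of p q v] by (simp add: alternating_def neg)
    show "alternating (q + 1) (\<phi>s q vac) = 0" if "q > 0"
      using that phis_vac[of "q - 1"] by (simp add: alternating_def)
    show "alternating p (\<phi> (- p) vac) = 0" if "p \<le> 0"
      using that by (simp add: alternating_def phi_vac)
    show "bra (alternating p (\<phi> (- p) v)) = 0" if "p > 0"
      using that by (simp add: alternating_def neg bra_phi)
    show "bra (alternating (q + 1) (\<phi>s q v)) = 0" if "q \<le> 0"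
      using that bra_phis[of "q - 1"] by (simp add: alternating_def neg)
  qed simp
qed

lemma (in bc_fermions) BC_op_eq_hop_chain:
  "B_op scale b c M = opser_lim (oscillators.hop_chain_up scale (\<lambda>p. b (1 - p)) (\<lambda>q. c (q - 1)) M)"
  "C_op scale b c M = opser_lim (oscillators.hop_chain_down scale (\<lambda>p. b (1 - p)) (\<lambda>q. c (q - 1)) M)"
proof -
  interpret oscillators scale "- 1" "\<lambda>p. b (1 - p)" "\<lambda>q. c (q - 1)" vac bra
    by (rule oscillators_bc)
  show "B_op scale b c M = opser_lim (hop_chain_up M)" "C_op scale b c M = opser_lim (hop_chain_down M)"
    unfolding B_op_def C_op_def hop_chain_up_def hop_chain_down_def Let_def hop_def
    by (simp_all add: algebra_simps)
qed

lemma (in charged_bosons) BsCs_op_eq_hop_chain: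
  "Bs_op scale \<phi> \<phi>s M = opser_lim (oscillators.hop_chain_up scale
     (\<lambda>p v. alternating p (\<phi> (- p) v)) (\<lambda>q v. alternating (q + 1) (\<phi>s q v)) M)"
  "Cs_op scale \<phi> \<phi>s M = opser_lim (oscillators.hop_chain_down scale
     (\<lambda>p v. alternating p (\<phi> (- p) v)) (\<lambda>q v. alternating (q + 1) (\<phi>s q v)) M)"
proof -
  interpret oscillators scale 1 "\<lambda>p v. alternating p (\<phi> (- p) v)"
      "\<lambda>q v. alternating (q + 1) (\<phi>s q v)" vac bra
    by (rule oscillators_phi)
  have neg: "\<phi> i (- v) = - \<phi> i v" for i v
    using linear_phi module_hom.neg unfolding module_hom_iff_linear[symmetric] by blast
  \<comment> \<open>For \<open>p\<close>, \<open>q\<close> of opposite parity the signs of \<open>u p\<close> and \<open>d q\<close> agree.\<close>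
  have "hop p q = (\<lambda>v. \<phi> (- p) (\<phi>s q v))" if "odd (p - q)" for p q
    using that unfolding hop_def by (auto simp: alternating_def neg)
  then show "Bs_op scale \<phi> \<phi>s M = opser_lim (hop_chain_up M)"
    "Cs_op scale \<phi> \<phi>s M = opser_lim (hop_chain_down M)"
    unfolding Bs_op_def Cs_op_def hop_chain_up_def hop_chain_down_def Let_def
    by (simp_all add: algebra_simps)
qed

theorem corollary3p2:
  fixes scaleF :: "'a::field_char_0 \<Rightarrow> 'v::ab_group_add \<Rightarrow> 'v"
    and b c :: "int \<Rightarrow> 'v \<Rightarrow> 'v" and vacF :: 'v and braF :: "'v \<Rightarrow> 'a"
    and scaleB :: "'a \<Rightarrow> 'w::ab_group_add \<Rightarrow> 'w"
    and \<phi> \<phi>s :: "int \<Rightarrow> 'w \<Rightarrow> 'w" and vacB :: 'w and braB :: "'w \<Rightarrow> 'a"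
    and M :: int and N :: nat
  assumes "bc_fermions scaleF b c vacF braF"
    and "charged_bosons scaleB \<phi> \<phi>s vacB braB"
    and "M > 0" and "N > 0"
  shows "vev_CB (Cs_op scaleB \<phi> \<phi>s M) (Bs_op scaleB \<phi> \<phi>s M) vacB braB N *
         vev_CB (C_op scaleF b c M) (B_op scaleF b c M) vacF braF N = 1"
  unfolding bc_fermions.BC_op_eq_hop_chain[OF assms(1)]
    charged_bosons.BsCs_op_eq_hop_chain[OF assms(2)]
  by (subst mult.commute, rule vev_CB_hop_chains)
     (rule bc_fermions.oscillators_bc[OF assms(1)] charged_bosons.oscillators_phi[OF assms(2)])+

end
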